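(* Let $R$ be a commutative ring with unity and let $m\ge1$ be an integer. Let $\{g_n(x)\}_{n\ge0}\subset R[x]$ be given by $$g_n(x)=\sum_{c=0}^{w_m(n)}\mu_1(n,c)\,x^{n-mc},\qquad \mu_1(n,0)\in R^\times\ \text{ for all } n\in\mathbb N,$$ with $\mu_1(n,c)\in R$. If two families $\{\mu_3^{(1)}(n,k)\}$ and $\{\mu_3^{(2)}(n,k)\}$ of elements of $R$ (indexed by $n\in\mathbb N$, $0\le k\le w_m(n)$) satisfy, for all $n\in\mathbb N$, $$x^n=\sum_{k=0}^{w_m(n)}\mu_3^{(1)}(n,k)\,g_{n-mk}(x)=\sum_{k=0}^{w_m(n)}\mu_3^{(2)}(n,k)\,g_{n-mk}(x),$$ then $\mu_3^{(1)}(n,k)=\mu_3^{(2)}(n,k)$ for all $n\in\mathbb N$ and $0\le k\le w_m(n)$. In particular, the inversion coefficients are unique whenever they exist.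
   Context: $\mathbb N=\{0,1,2,\dots\}$, $w_m(n)=\lfloor n/m\rfloor$, and $R^\times$ is the group of units of $R$. *)

theory Defs
  imports "HOL-Computational_Algebra.Polynomial" "HOL-Library.FuncSet"
begin

definition w :: "nat \<Rightarrow> nat \<Rightarrow> nat"
  where "w m n = n div m"

text \<open>
  The sort \<open>{comm_ring, comm_monoid_mult}\<close> describes commutative rings with unity
  without the axiom \<open>0 \<noteq> 1\<close> of \<open>comm_ring_1\<close>, so that the zero ring is included.
  A doubly indexed family is a total function \<open>nat \<Rightarrow> nat \<Rightarrow> 'a\<close>; only its values on
  \<open>index_set m\<close> are meaningful. The monomial \<open>x\<^sup>n\<close> is \<open>monom 1 n\<close>.
\<close>

definition index_set :: "nat \<Rightarrow> (nat \<times> nat) set"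
  where "index_set m = {(n, k). k \<le> w m n}"

definition inversion_coeffs ::
  "nat \<Rightarrow> (nat \<Rightarrow> 'a::{comm_ring, comm_monoid_mult} poly) \<Rightarrow> (nat \<Rightarrow> nat \<Rightarrow> 'a) \<Rightarrow> bool"
  where "inversion_coeffs m g \<mu> \<longleftrightarrow>
    (\<forall>n. monom 1 n = (\<Sum>k = 0..w m n. smult (\<mu> n k) (g (n - m * k))))"

end

theory Submission
  imports Defs
begin

text \<open>
  The polynomials \<open>g (n - m * k)\<close> have strictly decreasing degrees in \<open>k\<close> and unit leading
  coefficients, so comparing coefficients at those degrees, from the highest downwards,
  determines the coefficients of a linear combination of them one after the other.
\<close>

lemma mult_unit_eq_0:
  fixes d u :: "'a::{comm_ring, comm_monoid_mult}"
  assumes "u dvd 1" "d * u = 0"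
  shows "d = 0"
proof -
  obtain v where v: "1 = u * v" using assms(1) by (elim dvdE)
  have "d = d * (u * v)" unfolding v[symmetric] by (rule mult.comm_neutral[symmetric])
  also have "\<dots> = (d * u) * v" by (simp only: mult.assoc)
  finally show ?thesis by (simp add: assms(2))
qed

text \<open>The bound \<open>e j\<close> stands in for \<open>degree (p j)\<close>. Over a nonzero
  ring the two agree by \<open>deg\<close> and \<open>lead\<close>; over the zero ring every degree
  is 0, so degrees could not be strictly decreasing. Zero divisors are harmless because the leading
  coefficients are units and can be cancelled.\<close>

lemma triangular_coeffs_eq_0:
  fixes p :: "nat \<Rightarrow> 'a::{comm_ring, comm_monoid_mult} poly"
  assumes sum: "(\<Sum>k = 0..N. smult (d k) (p k)) = 0"
    and decreasing: "\<And>i j. i < j \<Longrightarrow> j \<le> N \<Longrightarrow> e j < e i"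
    and deg: "\<And>j i. j \<le> N \<Longrightarrow> e j < i \<Longrightarrow> coeff (p j) i = 0"
    and lead: "\<And>j. j \<le> N \<Longrightarrow> coeff (p j) (e j) dvd 1"
    and "k \<le> N"
  shows "d k = 0"
  using \<open>k \<le> N\<close>
proof (induction k rule: less_induct)
  case (less k)
  have "0 = coeff (\<Sum>j = 0..N. smult (d j) (p j)) (e k)"
    by (simp add: sum)
  also have "\<dots> = (\<Sum>j = 0..N. d j * coeff (p j) (e k))"
    by (simp add: coeff_sum)
  \<comment> \<open>In degree \<open>e k\<close> the terms with \<open>j < k\<close> vanish since
    \<open>d j = 0\<close> by induction, and those with \<open>j > k\<close> since
    \<open>e j < e k\<close> lies above their support.\<close>
  also have "\<dots> = (\<Sum>j = 0..N. if j = k then d k * coeff (p k) (e k) else 0)"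
  proof (rule sum.cong[OF refl])
    fix j assume "j \<in> {0..N}"
    then show "d j * coeff (p j) (e k) = (if j = k then d k * coeff (p k) (e k) else 0)"
      using less decreasing[of k j] deg[of j "e k"] by (cases j k rule: linorder_cases) auto
  qed
  also have "\<dots> = d k * coeff (p k) (e k)"
    using less.prems by simp
  finally show ?case
    using mult_unit_eq_0[OF lead[OF less.prems]] by simp
qed

theorem theorem2p6:
  fixes m :: nat
    and g :: "nat \<Rightarrow> 'a::{comm_ring, comm_monoid_mult} poly"
    and \<mu>\<^sub>1 :: "nat \<Rightarrow> nat \<Rightarrow> 'a"
  assumes "m \<ge> 1"
    and "\<And>n. g n = (\<Sum>c = 0..w m n. monom (\<mu>\<^sub>1 n c) (n - m * c))"
    and "\<And>n. \<mu>\<^sub>1 n 0 dvd 1"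
  shows "(\<forall>\<mu> \<nu>. inversion_coeffs m g \<mu> \<longrightarrow> inversion_coeffs m g \<nu> \<longrightarrow>
            (\<forall>n. \<forall>k\<le>w m n. \<mu> n k = \<nu> n k)) \<and>
         (\<exists>\<^sub>\<le>\<^sub>1 \<mu>. \<mu> \<in> extensional (index_set m) \<and> inversion_coeffs m g (curry \<mu>))"
proof -
  \<comment> \<open>Within the summation range the natural subtraction \<open>n - m * k\<close> is
    never truncated at 0.\<close>
  have le: "m * k \<le> n" if "k \<le> w m n" for k n
    using that assms(1) by (simp add: w_def less_eq_div_iff_mult_less_eq mult.commute)
  have deg: "coeff (g n) i = 0" if "n < i" for n i
    using that unfolding assms(2) by (auto simp: coeff_sum intro!: sum.neutral)
  have lead: "coeff (g n) n = \<mu>\<^sub>1 n 0" for n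
  proof -
    have "coeff (g n) n = (\<Sum>c = 0..w m n. if c = 0 then \<mu>\<^sub>1 n 0 else 0)"
      unfolding assms(2) coeff_sum
    proof (rule sum.cong[OF refl])
      fix c assume "c \<in> {0..w m n}"
      \<comment> \<open>The exponent drops by exactly \<open>m * c\<close>, so with
        \<open>m \<ge> 1\<close> only \<open>c = 0\<close> contributes in degree
        \<open>n\<close>.\<close>
      then have "n - m * c = n \<longleftrightarrow> m * c = 0"
        using le[of c n] by (simp del: mult_eq_0_iff mult_is_0) linarith
      then have "n - m * c = n \<longleftrightarrow> c = 0"
        using assms(1) by simp
      then show "coeff (monom (\<mu>\<^sub>1 n c) (n - m * c)) n = (if c = 0 then \<mu>\<^sub>1 n 0 else 0)"
        by auto
    qed
    then show ?thesis by simp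
  qed
  have unique: "\<mu> n k = \<nu> n k"
    if "inversion_coeffs m g \<mu>" "inversion_coeffs m g \<nu>" "k \<le> w m n" for \<mu> \<nu> n k
  proof -
    \<comment> \<open>Both families expand the same monomial, so their difference is a linear
      relation.\<close>
    have "(\<Sum>k = 0..w m n. smult (\<mu> n k - \<nu> n k) (g (n - m * k))) = 0"
      using that(1,2) unfolding inversion_coeffs_def
      by (simp add: smult_diff_left sum_subtractf)
    then have "\<mu> n k - \<nu> n k = 0"
    \<comment> \<open>At exponent \<open>n - m * k\<close> the polynomial
      \<open>g (n - m * k)\<close> has the unit \<open>\<mu>\<^sub>1 (n - m * k) 0\<close> as
      coefficient, and nothing above it.\<close>
    proof (rule triangular_coeffs_eq_0[where e = "\<lambda>k. n - m * k"])
      show "n - m * j < n - m * i" if "i < j" "j \<le> w m n" for i j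
      proof -
        have "m * i < m * j" using that(1) assms(1) by simp
        then show ?thesis using le[OF that(2)] by linarith
      qed
    qed (use that deg lead assms(3) in auto)
    then show ?thesis by simp
  qed
  \<comment> \<open>\<open>inversion_coeffs\<close> reads a family only on
    \<open>index_set m\<close>. Extensionality fixes all other values, so agreement on the index set
    becomes equality of functions; pairs and \<open>curry\<close> give the single argument that
    \<open>extensional\<close> expects.\<close>
  moreover have "\<exists>\<^sub>\<le>\<^sub>1 \<mu>. \<mu> \<in> extensional (index_set m) \<and> inversion_coeffs m g (curry \<mu>)"
  proof (rule Uniq_I, elim conjE)
    fix \<mu> \<nu>
    assume ext: "\<mu> \<in> extensional (index_set m)" "\<nu> \<in> extensional (index_set m)"
      and inv: "inversion_coeffs m g (curry \<mu>)" "inversion_coeffs m g (curry \<nu>)"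
    show "\<mu> = \<nu>"
      by (rule extensionalityI[OF ext]) (use unique[OF inv] in \<open>auto simp: index_set_def\<close>)
  qed
  ultimately show ?thesis by blast
qed

end
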